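(* Let $\mathscr{T} \subset \mathscr{L}(E)$ be a bounded abelian multiplicative semigroup of operators on a Banach space $E$, and let $\mathscr{N}(\mathscr{T}) = \{x \in E : Tx = x \text{ for all } T \in \mathscr{T}\}$ and $\mathscr{R}(\mathscr{T}) = \overline{\mathrm{lin}}\,\{Tx - x : T \in \mathscr{T},\ x \in E\}$. Then: (1) $\mathscr{N}(\mathscr{T}) \cap \mathscr{R}(\mathscr{T}) = \{0\}$; (2) the subspace $\mathscr{D}(\mathscr{T}) = \mathscr{N}(\mathscr{T}) + \mathscr{R}(\mathscr{T})$ is closed in $E$; and (3) the projection $P : \mathscr{D}(\mathscr{T}) \to \mathscr{N}(\mathscr{T})$ induced by the decomposition $\mathscr{D}(\mathscr{T}) = \mathscr{N}(\mathscr{T}) + \mathscr{R}(\mathscr{T})$ has norm not greater than $\sup_{T\in\mathscr{T}} \|T\|$.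
   Context: Banach spaces are real or complex; semigroups are non-empty. $\mathscr{L}(E)$ is the algebra of all bounded linear operators from $E$ into $E$. "Bounded" means $\sup_{T\in\mathscr{T}}\|T\|<\infty$. $\overline{\mathrm{lin}}$ denotes closed linear span. The projection induced by the decomposition is $y+z \mapsto y$ for $y \in \mathscr{N}(\mathscr{T})$, $z \in \mathscr{R}(\mathscr{T})$. *)

theory Defs
  imports "HOL-Analysis.Analysis"
begin

text \<open>
  Real and complex Banach spaces are treated uniformly. The real Banach space underlying \<open>E\<close> is
  given by the class \<^class>\<open>banach\<close>, and \<open>smul\<close> is a scalar multiplication on it extending
  \<^const>\<open>scaleR\<close>. The norm of a \<^class>\<open>real_normed_field\<close> is multiplicative, so by the
  Gelfand--Mazur theorem the scalar field is (isomorphic to) the reals or the complex numbers.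
\<close>

locale banach_space_over = vector_space smul
  for smul :: "'k::real_normed_field \<Rightarrow> 'a::banach \<Rightarrow> 'a" +
  assumes scale_of_real: "smul (of_real r) x = r *\<^sub>R x"
    and norm_scale: "norm (smul c x) = norm c * norm x"

lemma banach_space_over_real:
  "banach_space_over (scaleR :: real \<Rightarrow> 'a::banach \<Rightarrow> 'a)"
  by unfold_locales (auto simp: algebra_simps)

lemma banach_space_over_complex:
  "banach_space_over (\<lambda>(c::complex) (x :: complex ^ 'n). \<chi> i. c * x $ i)"
proof
  show "norm (\<chi> i. c * x $ i) = norm c * norm x" for c :: complex and x :: "complex ^ 'n"
    by (simp add: norm_vec_def norm_mult L2_set_right_distrib)
  show "(\<chi> i. of_real r * x $ i) = r *\<^sub>R x" for r :: real and x :: "complex ^ 'n"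
    unfolding vec_eq_iff by (simp add: scaleR_conv_of_real[where 'a=complex])
qed (simp_all add: vec_eq_iff algebra_simps)

text \<open>
  \<^typ>\<open>'a \<Rightarrow>\<^sub>L 'a\<close> consists of the bounded real-linear operators, normed by the operator norm;
  \<open>\<L>(E)\<close> consists of those that are linear over the scalar field of \<open>E\<close>.
\<close>

definition bounded_ops :: "('k::real_normed_field \<Rightarrow> 'a::banach \<Rightarrow> 'a) \<Rightarrow> ('a \<Rightarrow>\<^sub>L 'a) set" where
  "bounded_ops smul = {T. Vector_Spaces.linear smul smul (blinfun_apply T)}"

definition abelian_op_semigroup :: "('a::real_normed_vector \<Rightarrow>\<^sub>L 'a) set \<Rightarrow> bool" where
  "abelian_op_semigroup \<T> \<longleftrightarrow>
     \<T> \<noteq> {} \<and> (\<forall>S\<in>\<T>. \<forall>T\<in>\<T>. S o\<^sub>L T \<in> \<T>) \<and> (\<forall>S\<in>\<T>. \<forall>T\<in>\<T>. S o\<^sub>L T = T o\<^sub>L S)"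

definition fixed_space :: "('a::real_normed_vector \<Rightarrow>\<^sub>L 'a) set \<Rightarrow> 'a set" where
  "fixed_space \<T> = {x. \<forall>T\<in>\<T>. blinfun_apply T x = x}"

definition range_space ::
    "('k::real_normed_field \<Rightarrow> 'a::banach \<Rightarrow> 'a) \<Rightarrow> ('a \<Rightarrow>\<^sub>L 'a) set \<Rightarrow> 'a set" where
  "range_space smul \<T> = closure (module.span smul {blinfun_apply T x - x | T x. T \<in> \<T>})"

definition sum_space ::
    "('k::real_normed_field \<Rightarrow> 'a::banach \<Rightarrow> 'a) \<Rightarrow> ('a \<Rightarrow>\<^sub>L 'a) set \<Rightarrow> 'a set" where
  "sum_space smul \<T> = {y + z | y z. y \<in> fixed_space \<T> \<and> z \<in> range_space smul \<T>}"

text \<open>Only meaningful on \<^const>\<open>sum_space\<close>, and only if the decomposition is unique.\<close>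

definition induced_projection ::
    "('k::real_normed_field \<Rightarrow> 'a::banach \<Rightarrow> 'a) \<Rightarrow> ('a \<Rightarrow>\<^sub>L 'a) set \<Rightarrow> 'a \<Rightarrow> 'a" where
  "induced_projection smul \<T> x =
     (THE y. y \<in> fixed_space \<T> \<and> (\<exists>z\<in>range_space smul \<T>. x = y + z))"

text \<open>
  The operator norm of a linear map defined on a subspace \<open>S\<close>, where \<^const>\<open>onorm\<close> does not apply.
  It takes values in \<^typ>\<open>ereal\<close>, so that it is \<open>\<infinity>\<close> when the map is unbounded.
\<close>

definition onorm_on :: "'a::real_normed_vector set \<Rightarrow> ('a \<Rightarrow> 'b::real_normed_vector) \<Rightarrow> ereal" where
  "onorm_on S f = (SUP x\<in>{x\<in>S. norm x \<le> 1}. ereal (norm (f x)))"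

end

theory Submission
  imports Defs
begin

text \<open>
  Let \<open>M\<close> be the supremum of the operator norms. Everything follows from the single inequality
  \<open>norm y \<le> M * norm (y + z)\<close>, for \<open>y\<close> in the fixed space and \<open>z\<close> in the range space.
  It makes the decomposition unique (if \<open>y + z = 0\<close> then \<open>y = 0\<close>), it is the asserted bound on
  the projection, and it makes the sum closed: if \<open>y\<^sub>n + z\<^sub>n\<close> converges then \<open>y\<^sub>n\<close> is Cauchy, so both
  components converge, and both spaces are closed.

  The inequality comes from averaging. Every \<open>S\<close> in the convex hull of the semigroup has norm at
  most \<open>M\<close> and leaves \<open>y\<close> fixed, so
  \<open>norm y \<le> norm (S (y + z)) + norm (S z) \<le> M * norm (y + z) + norm (S z)\<close>,
  and it remains to see that \<open>S z\<close> can be made arbitrarily small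
  (\<open>range_space_null_under_averages\<close>). For \<open>z = T x - x\<close> the Cesaro means of the powers of \<open>T\<close>
  do this, as the sum telescopes (\<open>cesaro_telescoping\<close>). If \<open>S\<^sub>1\<close> makes \<open>z\<^sub>1\<close> small and \<open>S\<^sub>2\<close> makes \<open>z\<^sub>2\<close>
  small, then \<open>S\<^sub>1 S\<^sub>2 = S\<^sub>2 S\<^sub>1\<close>, which again belongs to the convex hull, makes \<open>z\<^sub>1 + z\<^sub>2\<close> small
  (\<open>null_under_averages_add\<close>); this is where commutativity enters. Uniform boundedness then
  extends the property from the linear span to its closure.
\<close>

section \<open>The convex hull of a commuting semigroup\<close>

lemma convex_hull_compose_closed:
  fixes \<T> :: "('a::real_normed_vector \<Rightarrow>\<^sub>L 'a) set"
  assumes "\<And>S T. S \<in> \<T> \<Longrightarrow> T \<in> \<T> \<Longrightarrow> S o\<^sub>L T \<in> \<T>"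
    and "S \<in> convex hull \<T>" and "T \<in> convex hull \<T>"
  shows "S o\<^sub>L T \<in> convex hull \<T>"
proof -
  let ?C = "convex hull \<T>"
  have left: "S o\<^sub>L R \<in> ?C" if "S \<in> \<T>" "R \<in> ?C" for S R
  proof -
    have "?C \<subseteq> (\<lambda>R. S o\<^sub>L R) -` ?C"
    proof (rule hull_minimal)
      show "\<T> \<subseteq> (\<lambda>R. S o\<^sub>L R) -` ?C"
        using assms(1) that(1) by (auto intro: hull_inc)
      show "convex ((\<lambda>R. S o\<^sub>L R) -` ?C)"
        by (intro convex_linear_vimage bounded_linear.linear convex_convex_hull
            bounded_bilinear.bounded_linear_right[OF bounded_bilinear_blinfun_compose])
    qed
    then show ?thesis using that(2) by auto
  qed
  have "?C \<subseteq> (\<lambda>R. R o\<^sub>L T) -` ?C"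
  proof (rule hull_minimal)
    show "\<T> \<subseteq> (\<lambda>R. R o\<^sub>L T) -` ?C"
      using left assms(3) by auto
    show "convex ((\<lambda>R. R o\<^sub>L T) -` ?C)"
      by (intro convex_linear_vimage bounded_linear.linear convex_convex_hull
          bounded_bilinear.bounded_linear_left[OF bounded_bilinear_blinfun_compose])
  qed
  then show ?thesis using assms(2) by auto
qed

lemma convex_commutant:
  fixes R :: "'a::real_normed_vector \<Rightarrow>\<^sub>L 'a"
  shows "convex {S. S o\<^sub>L R = R o\<^sub>L S}"
  by (auto simp: convex_def bounded_bilinear.add_left[OF bounded_bilinear_blinfun_compose]
      bounded_bilinear.add_right[OF bounded_bilinear_blinfun_compose]
      bounded_bilinear.scaleR_left[OF bounded_bilinear_blinfun_compose]
      bounded_bilinear.scaleR_right[OF bounded_bilinear_blinfun_compose])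

lemma convex_hull_commute:
  fixes \<T> :: "('a::real_normed_vector \<Rightarrow>\<^sub>L 'a) set"
  assumes "\<And>S T. S \<in> \<T> \<Longrightarrow> T \<in> \<T> \<Longrightarrow> S o\<^sub>L T = T o\<^sub>L S"
    and "S \<in> convex hull \<T>" and "T \<in> convex hull \<T>"
  shows "S o\<^sub>L T = T o\<^sub>L S"
proof -
  have right: "R o\<^sub>L T = T o\<^sub>L R" if "R \<in> \<T>" for R
  proof -
    have "convex hull \<T> \<subseteq> {S. S o\<^sub>L R = R o\<^sub>L S}"
      by (rule hull_minimal) (use assms(1) that in \<open>auto intro: convex_commutant\<close>)
    then show ?thesis using assms(3) by auto
  qed
  have "convex hull \<T> \<subseteq> {S. S o\<^sub>L T = T o\<^sub>L S}"
    by (rule hull_minimal) (use right in \<open>auto intro: convex_commutant\<close>)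
  then show ?thesis using assms(2) by auto
qed

lemma convex_hull_norm_le:
  fixes \<T> :: "'a::real_normed_vector set"
  assumes "\<And>T. T \<in> \<T> \<Longrightarrow> norm T \<le> M" and "S \<in> convex hull \<T>"
  shows "norm S \<le> M"
proof -
  have "convex hull \<T> \<subseteq> cball 0 M"
    by (rule hull_minimal) (use assms(1) in auto)
  then show ?thesis using assms(2) by auto
qed

lemma convex_hull_fixes:
  assumes "y \<in> fixed_space \<T>" and "S \<in> convex hull \<T>"
  shows "blinfun_apply S y = y"
proof -
  have "convex hull \<T> \<subseteq> {S. blinfun_apply S y = y}"
  proof (rule hull_minimal)
    show "\<T> \<subseteq> {S. blinfun_apply S y = y}"
      using assms(1) by (auto simp: fixed_space_def)
    show "convex {S. blinfun_apply S y = y}"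
      by (auto simp: convex_def blinfun.add_left blinfun.scaleR_left simp flip: scaleR_add_left)
  qed
  then show ?thesis using assms(2) by auto
qed

text \<open>
  The witness \<open>A\<close> is the mean of \<open>T, T\<^sup>2, \<dots>, T\<^bsup>n+1\<^esup>\<close> and \<open>P\<close> is \<open>T\<^bsup>n+2\<^esup>\<close>. Starting the mean at \<open>T\<close>
  rather than at the identity keeps it in the convex hull, since a semigroup of operators may
  lack the identity.
\<close>

lemma cesaro_telescoping:
  fixes \<T> :: "('a::real_normed_vector \<Rightarrow>\<^sub>L 'a) set"
  assumes comp: "\<And>S T. S \<in> \<T> \<Longrightarrow> T \<in> \<T> \<Longrightarrow> S o\<^sub>L T \<in> \<T>" and T: "T \<in> \<T>"
  shows "\<exists>A\<in>convex hull \<T>. \<exists>P\<in>\<T>. \<forall>x. real (Suc n) *\<^sub>R blinfun_apply A (blinfun_apply T x - x)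
            = blinfun_apply P x - blinfun_apply T x"
proof (induction n)
  case 0
  show ?case
    using T comp[OF T T]
    by (intro bexI[of _ T] bexI[of _ "T o\<^sub>L T"]) (auto simp: blinfun.diff_right intro: hull_inc)
next
  case (Suc n)
  then obtain A P where A: "A \<in> convex hull \<T>" and P: "P \<in> \<T>"
    and AP: "\<And>x. real (Suc n) *\<^sub>R blinfun_apply A (blinfun_apply T x - x)
            = blinfun_apply P x - blinfun_apply T x" by blast
  let ?N = "real (Suc (Suc n))"
  let ?B = "(real (Suc n) / ?N) *\<^sub>R A + (1 / ?N) *\<^sub>R P"
  have B: "?B \<in> convex hull \<T>"
    by (rule convexD[OF convex_convex_hull A hull_inc[OF P]]) (auto simp: field_simps)
  have "?N *\<^sub>R blinfun_apply ?B (blinfun_apply T x - x)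
            = blinfun_apply (P o\<^sub>L T) x - blinfun_apply T x" for x
  proof -
    have "?N *\<^sub>R blinfun_apply ?B (blinfun_apply T x - x)
        = real (Suc n) *\<^sub>R blinfun_apply A (blinfun_apply T x - x)
          + blinfun_apply P (blinfun_apply T x - x)"
      by (simp add: blinfun.add_left blinfun.scaleR_left scaleR_add_right del: of_nat_Suc)
    then show ?thesis
      unfolding AP by (simp add: blinfun.diff_right)
  qed
  then show ?case
    using B comp[OF P T] by blast
qed

section \<open>Vectors made small by averaging\<close>

definition null_under_averages :: "('a::real_normed_vector \<Rightarrow>\<^sub>L 'a) set \<Rightarrow> 'a \<Rightarrow> bool" where
  "null_under_averages \<T> z \<longleftrightarrow> (\<forall>e>0. \<exists>S\<in>convex hull \<T>. norm (blinfun_apply S z) < e)"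

lemma null_under_averages_add:
  fixes \<T> :: "('a::real_normed_vector \<Rightarrow>\<^sub>L 'a) set"
  assumes ab: "abelian_op_semigroup \<T>" and bd: "\<And>T. T \<in> \<T> \<Longrightarrow> norm T \<le> M"
    and z: "null_under_averages \<T> z1" "null_under_averages \<T> z2"
  shows "null_under_averages \<T> (z1 + z2)"
  unfolding null_under_averages_def
proof (intro allI impI)
  fix e :: real assume e: "e > 0"
  have M: "M \<ge> 0"
    using ab bd order_trans[OF norm_ge_zero] unfolding abelian_op_semigroup_def
    by (metis ex_in_conv)
  \<comment> \<open>Each summand is hit by one more operator of norm at most \<open>M\<close>; the denominator \<open>M + 1\<close>
      also covers \<open>M = 0\<close>.\<close>
  define d where "d = e / (2 * (M + 1))"
  have d: "d > 0" and "2 * (M + 1) * d = e"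
    using e M by (auto simp: d_def)
  then have Md: "M * d + M * d < e"
    by (simp add: algebra_simps)
  obtain S1 where S1: "S1 \<in> convex hull \<T>" "norm (blinfun_apply S1 z1) < d"
    using z(1) d unfolding null_under_averages_def by blast
  obtain S2 where S2: "S2 \<in> convex hull \<T>" "norm (blinfun_apply S2 z2) < d"
    using z(2) d unfolding null_under_averages_def by blast
  have comm: "S1 o\<^sub>L S2 = S2 o\<^sub>L S1"
    by (rule convex_hull_commute[OF _ S1(1) S2(1)])
      (use ab in \<open>auto simp: abelian_op_semigroup_def\<close>)
  have mem: "S1 o\<^sub>L S2 \<in> convex hull \<T>"
    by (rule convex_hull_compose_closed[OF _ S1(1) S2(1)])
      (use ab in \<open>auto simp: abelian_op_semigroup_def\<close>)
  have small: "norm (blinfun_apply S w) \<le> M * d" if "S \<in> convex hull \<T>" "norm w < d" for S w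
  proof -
    have "norm (blinfun_apply S w) \<le> norm S * norm w" by (rule norm_blinfun)
    also have "\<dots> \<le> M * d"
      using convex_hull_norm_le[OF bd that(1)] that(2) M by (intro mult_mono) auto
    finally show ?thesis .
  qed
  have "blinfun_apply (S1 o\<^sub>L S2) (z1 + z2)
      = blinfun_apply (S2 o\<^sub>L S1) z1 + blinfun_apply (S1 o\<^sub>L S2) z2"
    by (simp add: blinfun.add_right flip: comm)
  also have "norm \<dots> \<le> M * d + M * d"
    using norm_triangle_mono[OF small[OF S2(1) S1(2)] small[OF S1(1) S2(2)]] by simp
  finally show "\<exists>S\<in>convex hull \<T>. norm (blinfun_apply S (z1 + z2)) < e"
    using mem Md by (blast intro: le_less_trans)
qed

lemma null_under_averages_diff:
  fixes \<T> :: "('a::real_normed_vector \<Rightarrow>\<^sub>L 'a) set"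
  assumes comp: "\<And>S T. S \<in> \<T> \<Longrightarrow> T \<in> \<T> \<Longrightarrow> S o\<^sub>L T \<in> \<T>"
    and bd: "\<And>T. T \<in> \<T> \<Longrightarrow> norm T \<le> M" and T: "T \<in> \<T>"
  shows "null_under_averages \<T> (blinfun_apply T x - x)"
  unfolding null_under_averages_def
proof (intro allI impI)
  fix e :: real assume e: "e > 0"
  obtain n where n: "2 * M * norm x / e < real n"
    using reals_Archimedean2 by blast
  obtain A P where A: "A \<in> convex hull \<T>" and P: "P \<in> \<T>"
    and AP: "real (Suc n) *\<^sub>R blinfun_apply A (blinfun_apply T x - x)
            = blinfun_apply P x - blinfun_apply T x"
    using cesaro_telescoping[OF comp T] by blast
  have le: "norm (blinfun_apply R x) \<le> M * norm x" if "R \<in> \<T>" for R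
    using norm_blinfun[of R x] mult_right_mono[OF bd[OF that] norm_ge_zero[of x]] by linarith
  have "real (Suc n) * norm (blinfun_apply A (blinfun_apply T x - x))
      = norm (blinfun_apply P x - blinfun_apply T x)"
    by (simp flip: AP)
  also have "\<dots> \<le> 2 * M * norm x"
    using norm_triangle_ineq4[of "blinfun_apply P x" "blinfun_apply T x"] le[OF P] le[OF T] by simp
  also have "\<dots> < real n * e"
    using n e by (simp add: field_simps)
  also have "\<dots> < real (Suc n) * e"
    using e by simp
  finally have "norm (blinfun_apply A (blinfun_apply T x - x)) < e"
    by (simp del: of_nat_Suc)
  with A show "\<exists>S\<in>convex hull \<T>. norm (blinfun_apply S (blinfun_apply T x - x)) < e" by blast
qed

lemma null_under_averages_closure:
  fixes \<T> :: "('a::real_normed_vector \<Rightarrow>\<^sub>L 'a) set"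
  assumes bd: "\<And>T. T \<in> \<T> \<Longrightarrow> norm T \<le> M"
    and Z: "\<And>z. z \<in> Z \<Longrightarrow> null_under_averages \<T> z" and z: "z \<in> closure Z"
  shows "null_under_averages \<T> z"
  unfolding null_under_averages_def
proof (intro allI impI)
  fix e :: real assume e: "e > 0"
  define d where "d = e / (2 * (\<bar>M\<bar> + 1))"
  have d: "d > 0" and "2 * (\<bar>M\<bar> + 1) * d = e"
    using e by (auto simp: d_def)
  then have Md: "\<bar>M\<bar> * d < e / 2"
    by (simp add: algebra_simps)
  obtain w where w: "w \<in> Z" "dist w z < d"
    using z d unfolding closure_approachable by blast
  obtain S where S: "S \<in> convex hull \<T>" "norm (blinfun_apply S w) < e / 2"
    using Z[OF w(1)] e unfolding null_under_averages_def by (meson half_gt_zero)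
  have "norm (blinfun_apply S (z - w)) \<le> norm S * norm (z - w)" by (rule norm_blinfun)
  also have "\<dots> \<le> \<bar>M\<bar> * d"
    using convex_hull_norm_le[OF bd S(1)] w(2)
    by (intro mult_mono) (auto simp: dist_norm norm_minus_commute)
  finally have "norm (blinfun_apply S w + blinfun_apply S (z - w)) < e / 2 + e / 2"
    using S(2) Md by (intro norm_add_less) auto
  then show "\<exists>S\<in>convex hull \<T>. norm (blinfun_apply S z) < e"
    using S(1) by (auto simp: blinfun.diff_right)
qed

lemma bounded_ops_scale:
  "T \<in> bounded_ops smul \<Longrightarrow> blinfun_apply T (smul c x) = smul c (blinfun_apply T x)"
  by (simp add: bounded_ops_def Vector_Spaces.linear_def module_hom.scale)

text \<open>
  The set of generators \<open>T x - x\<close> is invariant under scalars, because \<open>c (T x - x) = T (c x) - c x\<close>.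
  Hence the span consists of finite sums of generators, and additivity of the property suffices.
\<close>

lemma range_space_null_under_averages:
  fixes smul :: "'k::real_normed_field \<Rightarrow> 'a::banach \<Rightarrow> 'a"
  assumes bs: "banach_space_over smul" and lin: "\<T> \<subseteq> bounded_ops smul"
    and ab: "abelian_op_semigroup \<T>" and bd: "\<And>T. T \<in> \<T> \<Longrightarrow> norm T \<le> M"
    and z: "z \<in> range_space smul \<T>"
  shows "null_under_averages \<T> z"
proof (rule null_under_averages_closure[OF bd _ z[unfolded range_space_def]])
  interpret banach_space_over smul by (rule bs)
  fix z assume "z \<in> span {blinfun_apply T x - x | T x. T \<in> \<T>}"
  then show "null_under_averages \<T> z"
  proof (induction rule: span_induct_alt)
    case base
    have "convex hull \<T> \<noteq> {}"
      using ab by (simp add: abelian_op_semigroup_def)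
    then show ?case
      by (auto simp: null_under_averages_def)
  next
    case (step c x y)
    then obtain T u where T: "T \<in> \<T>" and x: "x = blinfun_apply T u - u" by blast
    have "smul c x = blinfun_apply T (smul c u) - smul c u"
      using bounded_ops_scale[of T smul] lin T by (auto simp: x scale_right_diff_distrib)
    moreover have "null_under_averages \<T> (blinfun_apply T (smul c u) - smul c u)"
      by (rule null_under_averages_diff[OF _ bd T]) (use ab in \<open>auto simp: abelian_op_semigroup_def\<close>)
    ultimately show ?case
      using null_under_averages_add[OF ab bd _ step(2)] by simp
  qed
qed

lemma fixed_space_norm_le:
  fixes \<T> :: "('a::real_normed_vector \<Rightarrow>\<^sub>L 'a) set"
  assumes bd: "\<And>T. T \<in> \<T> \<Longrightarrow> norm T \<le> M"
    and y: "y \<in> fixed_space \<T>" and z: "null_under_averages \<T> z"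
  shows "norm y \<le> M * norm (y + z)"
proof (rule field_le_epsilon)
  fix e :: real assume "e > 0"
  then obtain S where S: "S \<in> convex hull \<T>" "norm (blinfun_apply S z) < e"
    using z unfolding null_under_averages_def by blast
  have "y = blinfun_apply S (y + z) - blinfun_apply S z"
    using convex_hull_fixes[OF y S(1)] by (simp add: blinfun.add_right)
  then have "norm y \<le> norm (blinfun_apply S (y + z)) + norm (blinfun_apply S z)"
    by (metis norm_triangle_ineq4)
  also have "norm (blinfun_apply S (y + z)) \<le> norm S * norm (y + z)"
    by (rule norm_blinfun)
  also have "norm S * norm (y + z) \<le> M * norm (y + z)"
    using convex_hull_norm_le[OF bd S(1)] by (intro mult_right_mono) auto
  finally show "norm y \<le> M * norm (y + z) + e"
    using S(2) by linarith
qed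

section \<open>The two summands and their sum\<close>

lemma (in banach_space_over) subspace_closure:
  assumes "subspace S"
  shows "subspace (closure S)"
proof (rule subspaceI)
  show "0 \<in> closure S"
    using subspace_0[OF assms] closure_subset by blast
next
  fix x y assume "x \<in> closure S" "y \<in> closure S"
  then obtain f g where f: "\<And>n. f n \<in> S" "f \<longlonglongrightarrow> x" and g: "\<And>n. g n \<in> S" "g \<longlonglongrightarrow> y"
    unfolding closure_sequential by blast
  show "x + y \<in> closure S"
    unfolding closure_sequential
    by (intro exI[of _ "\<lambda>n. f n + g n"] conjI allI subspace_add[OF assms] tendsto_add f g)
next
  fix c :: 'k and x assume "x \<in> closure S"
  then obtain f where f: "\<And>n. f n \<in> S" "f \<longlonglongrightarrow> x"
    unfolding closure_sequential by blast
  have "(\<lambda>n. norm c * norm (f n - x)) \<longlonglongrightarrow> norm c * 0"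
    by (intro tendsto_mult_left tendsto_norm_zero LIM_zero f(2))
  then have "(\<lambda>n. smul c (f n) - smul c x) \<longlonglongrightarrow> 0"
    by (simp only: scale_right_diff_distrib[symmetric] norm_scale[symmetric] mult_zero_right
        tendsto_norm_zero_iff)
  then have "(\<lambda>n. smul c (f n)) \<longlonglongrightarrow> smul c x"
    by (rule LIM_zero_cancel)
  then show "smul c x \<in> closure S"
    unfolding closure_sequential
    by (intro exI[of _ "\<lambda>n. smul c (f n)"] conjI allI subspace_scale[OF assms] f(1))
qed

lemma (in banach_space_over) subspace_range_space: "subspace (range_space smul \<T>)"
  unfolding range_space_def by (intro subspace_closure subspace_span)

lemma (in banach_space_over) subspace_fixed_space:
  assumes "\<T> \<subseteq> bounded_ops smul"
  shows "subspace (fixed_space \<T>)"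
proof (rule subspaceI)
  fix c x assume "x \<in> fixed_space \<T>"
  then show "smul c x \<in> fixed_space \<T>"
    using assms by (auto simp: fixed_space_def subset_iff bounded_ops_scale[of _ smul])
qed (auto simp: fixed_space_def blinfun.add_right)

lemma closed_fixed_space: "closed (fixed_space \<T>)"
proof -
  have "fixed_space \<T> = (\<Inter>T\<in>\<T>. {x. blinfun_apply T x = x})"
    by (auto simp: fixed_space_def)
  then show ?thesis
    by (auto intro!: closed_INT closed_Collect_eq continuous_intros)
qed

text \<open>
  The hypothesis bounds the projection onto \<open>Y\<close> along \<open>Z\<close>, so a convergent sequence in the sum has
  Cauchy, hence convergent, \<open>Y\<close>-components.
\<close>

lemma closed_sum_of_bounded_projection:
  fixes Y Z :: "'a::banach set"
  assumes Y: "closed Y" "\<And>u v. u \<in> Y \<Longrightarrow> v \<in> Y \<Longrightarrow> u - v \<in> Y"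
    and Z: "closed Z" "\<And>u v. u \<in> Z \<Longrightarrow> v \<in> Z \<Longrightarrow> u - v \<in> Z"
    and est: "\<And>y z. y \<in> Y \<Longrightarrow> z \<in> Z \<Longrightarrow> norm y \<le> M * norm (y + z)"
  shows "closed {y + z | y z. y \<in> Y \<and> z \<in> Z}"
  unfolding closed_sequential_limits
proof (intro allI impI)
  fix f l assume "(\<forall>n. f n \<in> {y + z | y z. y \<in> Y \<and> z \<in> Z}) \<and> f \<longlonglongrightarrow> l"
  then have ex: "\<forall>n. \<exists>y z. f n = y + z \<and> y \<in> Y \<and> z \<in> Z" and lim: "f \<longlonglongrightarrow> l" by auto
  obtain y z where yz: "\<And>n. f n = y n + z n" "\<And>n. y n \<in> Y" "\<And>n. z n \<in> Z"
    using ex by metis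
  have dist_le: "dist (y m) (y n) \<le> M * dist (f m) (f n)" for m n
    using est[OF Y(2) Z(2), OF yz(2) yz(2) yz(3) yz(3), of m n m n]
    by (simp add: dist_norm yz(1) algebra_simps)
  have "Cauchy y"
    unfolding Cauchy_def
  proof (intro allI impI)
    fix e :: real assume e: "e > 0"
    have "e / (\<bar>M\<bar> + 1) > 0" using e by simp
    then obtain N where N: "\<And>m n. m \<ge> N \<Longrightarrow> n \<ge> N \<Longrightarrow> dist (f m) (f n) < e / (\<bar>M\<bar> + 1)"
      using LIMSEQ_imp_Cauchy[OF lim] unfolding Cauchy_def by blast
    have "dist (y m) (y n) < e" if "m \<ge> N" "n \<ge> N" for m n
    proof -
      have "dist (y m) (y n) \<le> (\<bar>M\<bar> + 1) * dist (f m) (f n)"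
        using dist_le[of m n] by (rule order_trans) (auto intro: mult_right_mono)
      also have "\<dots> < e"
        using N[OF that] by (simp add: pos_less_divide_eq mult.commute)
      finally show ?thesis .
    qed
    then show "\<exists>N. \<forall>m\<ge>N. \<forall>n\<ge>N. dist (y m) (y n) < e" by blast
  qed
  then obtain u where u: "y \<longlonglongrightarrow> u"
    using Cauchy_convergent convergent_def by blast
  have uY: "u \<in> Y"
    using closed_sequentially[OF Y(1) yz(2) u] .
  have "(\<lambda>n. f n - y n) \<longlonglongrightarrow> l - u"
    using lim u by (rule tendsto_diff)
  then have "z \<longlonglongrightarrow> l - u" by (simp add: yz(1))
  then have "l - u \<in> Z"
    by (rule closed_sequentially[OF Z(1) yz(3)])
  then show "l \<in> {y + z | y z. y \<in> Y \<and> z \<in> Z}"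
    using uY by force
qed

theorem theorem1p3:
  fixes smul :: "'k::real_normed_field \<Rightarrow> 'a::banach \<Rightarrow> 'a"
    and \<T> :: "('a \<Rightarrow>\<^sub>L 'a) set"
  assumes "banach_space_over smul"
    and "\<T> \<subseteq> bounded_ops smul"
    and "abelian_op_semigroup \<T>"
    and "bdd_above (norm ` \<T>)"
  shows "fixed_space \<T> \<inter> range_space smul \<T> = {0}
    \<and> (module.subspace smul (sum_space smul \<T>) \<and> closed (sum_space smul \<T>))
    \<and> (\<forall>y\<in>fixed_space \<T>. \<forall>z\<in>range_space smul \<T>. induced_projection smul \<T> (y + z) = y)
    \<and> onorm_on (sum_space smul \<T>) (induced_projection smul \<T>) \<le> ereal (SUP T\<in>\<T>. norm T)"
proof -
  interpret banach_space_over smul by (rule assms(1))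
  let ?N = "fixed_space \<T>" and ?R = "range_space smul \<T>" and ?D = "sum_space smul \<T>"
  let ?P = "induced_projection smul \<T>"
  define M where "M = (SUP T\<in>\<T>. norm T)"
  have bd: "norm T \<le> M" if "T \<in> \<T>" for T
    unfolding M_def using that assms(4) by (rule cSUP_upper)
  have M: "M \<ge> 0"
    using assms(3) bd order_trans[OF norm_ge_zero] unfolding abelian_op_semigroup_def
    by (metis ex_in_conv)
  have N: "subspace ?N" by (rule subspace_fixed_space[OF assms(2)])
  have R: "subspace ?R" by (rule subspace_range_space)
  have est: "norm y \<le> M * norm (y + z)" if "y \<in> ?N" "z \<in> ?R" for y z
    using fixed_space_norm_le[OF bd that(1)]
      range_space_null_under_averages[OF assms(1-3) bd that(2)] by blast
  have inter: "x = 0" if "x \<in> ?N" "x \<in> ?R" for x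
    using est[OF that(1) subspace_neg[OF R that(2)]] by simp
  have proj: "?P (y + z) = y" if "y \<in> ?N" "z \<in> ?R" for y z
    unfolding induced_projection_def
  proof (rule the_equality)
    show "y \<in> ?N \<and> (\<exists>z'\<in>?R. y + z = y + z')" using that by blast
    fix y' assume "y' \<in> ?N \<and> (\<exists>z'\<in>?R. y + z = y' + z')"
    then obtain z' where y': "y' \<in> ?N" "z' \<in> ?R" "y + z = y' + z'" by blast
    then have "y' - y = z - z'" by (simp add: algebra_simps)
    then have "y' - y = 0"
      using inter subspace_diff[OF N y'(1) that(1)] subspace_diff[OF R that(2) y'(2)] by metis
    then show "y' = y" by simp
  qed
  have sub: "subspace ?D"
    unfolding sum_space_def by (rule subspace_sums[OF N R])
  have "closed ?R" by (simp add: range_space_def)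
  then have closed: "closed ?D"
    unfolding sum_space_def
    by (intro closed_sum_of_bounded_projection[OF closed_fixed_space _ _ _ est])
      (auto intro: subspace_diff[OF N] subspace_diff[OF R])
  have "onorm_on ?D ?P \<le> ereal M"
    unfolding onorm_on_def
  proof (rule SUP_least)
    fix x assume "x \<in> {x \<in> ?D. norm x \<le> 1}"
    then obtain y z where x: "x = y + z" "y \<in> ?N" "z \<in> ?R" "norm x \<le> 1"
      unfolding sum_space_def by blast
    have "norm (?P x) \<le> M * norm x"
      using est[OF x(2,3)] proj[OF x(2,3)] x(1) by simp
    also have "\<dots> \<le> M"
      using M x(4) by (simp add: mult_left_le)
    finally show "ereal (norm (?P x)) \<le> ereal M" by simp
  qed
  moreover have "?N \<inter> ?R = {0}"
    using inter subspace_0[OF N] subspace_0[OF R] by blast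
  ultimately show ?thesis
    using sub closed proj unfolding M_def by simp
qed

end
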